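(* Let $k\ge1$, let $n_1,\dots,n_k\ge 2$ be pairwise relatively prime integers, let $r_1,\dots,r_k\ge 1$ and $m\ge 0$ be integers, put $s=r_1+\cdots+r_k$, and let $p(x)\in\mathbb{Q}[x]$ with $\deg p<m+r_1n_1+\cdots+r_kn_k$. Then $$ \frac{p(x)}{(1-x)^m}\prod_{j=1}^k\frac{1}{(1-x^{n_j})^{r_j}}=\sum_{j=0}^{m+s-1}\frac{c_j}{(1-x)^{m+s-j}}+\sum_{j=1}^k\frac{g_j(x)}{(1-x^{n_j})^{r_j}} =\sum_{j=0}^{m+s-1}\frac{c_j}{(1-x)^{m+s-j}}+\sum_{j=1}^k\sum_{i=0}^{r_j-1}\frac{g_{ij}(x)}{(1-x^{n_j})^{r_j-i}}, $$ where $g_{ij}(x)$ are polynomials with $\deg g_{ij}<n_j$ and $g_j(x)=\sum_{i=0}^{r_j-1}g_{ij}(x)(1-x^{n_j})^i$; for $0\le j\le m+s-1$, $$ c_j=\frac{1}{n_1^{r_1}\cdots n_k^{r_k}}\sum_{i_0+i_1+\cdots+i_k=j}(-1)^j\frac{D^{(i_0)}p(1)}{i_0!}\,\frac{\tilde\beta^{(r_1)}_{i_1}(n_1)\cdots\tilde\beta^{(r_k)}_{i_k}(n_k)}{i_1!\cdots i_k!} $$ (sum over nonnegative integers $i_0,\dots,i_k$); and for $1\le j\le k$, $$ g_j(x)=(1-x)^{r_j}\,\mathrm{eval}\!\left(\frac{p(x)}{(1-x)^{m+s}}\prod_{\substack{i=1\\ i\ne j}}^k\frac{1}{\Psi_{n_i}(x)^{r_i}};\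 \Psi_{n_j}(x)^{r_j}\right),\qquad \deg g_j<n_jr_j . $$
   Context: $D^{(i)}p(1)$ is the $i$-th derivative of $p$ evaluated at $x=1$. For a positive integer $n$, $\Psi_n(x)=\frac{1-x^n}{1-x}=x^{n-1}+\cdots+x+1$. Evaluation operator: for $r(x),s(x),a(x)\in\mathbb{Q}[x]$ with $a$ non-constant and $\gcd(s,a)=1$, $\mathrm{eval}\left(\frac{r(x)}{s(x)};a(x)\right)$ is the remainder of $\alpha(x)r(x)$ on division by $a(x)$, where $\alpha(x)\in\mathbb{Q}[x]$ satisfies $\alpha(x)s(x)\equiv1\pmod{a(x)}$. (The result does not depend on the choice of $\alpha$ or of the representation of the fraction.) The reciprocal degenerate Bernoulli numbers of order $r$, $\tilde\beta^{(r)}_k(n)$, are defined by the expansion about $x=1$ $$\left(\frac{n}{\Psi_n(x)}\right)^r=\sum_{k=0}^\infty(-1)^k\frac{\tilde\beta^{(r)}_k(n)}{k!}(1-x)^k.$$ *)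

theory Defs
  imports
    "HOL-Computational_Algebra.Computational_Algebra"
    "HOL-Computational_Algebra.Field_as_Ring"
    "HOL-Number_Theory.Cong"
    "HOL-Library.FuncSet"
begin

abbreviation X :: "rat poly" where
  "X \<equiv> [:0, 1:]"

definition Psi :: "nat \<Rightarrow> rat poly" where
  "Psi n = (\<Sum>i<n. X ^ i)"

lemma one_minus_X_mult_Psi: "(1 - X) * Psi n = 1 - X ^ n"
  unfolding Psi_def by (rule one_diff_power_eq[symmetric])

text \<open>
  Rational functions are elements of the fraction field \<^typ>\<open>rat poly fract\<close>. The value does not
  depend on the representation \<open>f = r/s\<close> or on the inverse \<open>\<alpha>\<close> of \<open>s\<close> modulo \<open>a\<close>, see
  \<open>eval_mod_Fract\<close> below. It is unspecified if no denominator of \<open>f\<close> is coprime to \<open>a\<close>.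
\<close>

definition eval_mod :: "rat poly fract \<Rightarrow> rat poly \<Rightarrow> rat poly" where
  "eval_mod f a = (THE b. \<exists>r s \<alpha>. s \<noteq> 0 \<and> f = to_fract r / to_fract s \<and> coprime s a \<and>
     [\<alpha> * s = 1] (mod a) \<and> b = (\<alpha> * r) mod a)"

lemma eval_mod_Fract:
  assumes s: "s \<noteq> 0" "coprime s a" and \<alpha>: "[\<alpha> * s = 1] (mod a)"
  shows "eval_mod (to_fract r / to_fract s) a = (\<alpha> * r) mod a"
  unfolding eval_mod_def
proof (rule the_equality)
  show "\<exists>r' s' \<alpha>'. s' \<noteq> 0 \<and> to_fract r / to_fract s = to_fract r' / to_fract s' \<and>
     coprime s' a \<and> [\<alpha>' * s' = 1] (mod a) \<and> (\<alpha> * r) mod a = (\<alpha>' * r') mod a"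
    using assms by blast
next
  fix b
  assume "\<exists>r' s' \<alpha>'. s' \<noteq> 0 \<and> to_fract r / to_fract s = to_fract r' / to_fract s' \<and>
     coprime s' a \<and> [\<alpha>' * s' = 1] (mod a) \<and> b = (\<alpha>' * r') mod a"
  then obtain r' s' \<alpha>' where s': "s' \<noteq> 0"
    and eq: "to_fract r / to_fract s = to_fract r' / to_fract s'"
    and \<alpha>': "[\<alpha>' * s' = 1] (mod a)" and b: "b = (\<alpha>' * r') mod a" by blast
  have "to_fract (r * s') = to_fract (r' * s)"
    using eq s s' by (simp add: field_simps)
  then have rs: "r * s' = r' * s" by (simp only: to_fract_eq_iff)
  have "[\<alpha>' * r' * (\<alpha> * s) = \<alpha>' * r' * 1] (mod a)"
    using \<alpha> by (rule cong_scalar_left)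
  moreover have "\<alpha>' * r' * (\<alpha> * s) = \<alpha> * r * (\<alpha>' * s')"
    using rs by (simp add: algebra_simps)
  moreover have "[\<alpha> * r * (\<alpha>' * s') = \<alpha> * r * 1] (mod a)"
    using \<alpha>' by (rule cong_scalar_left)
  ultimately have "[\<alpha>' * r' = \<alpha> * r] (mod a)"
    by (metis cong_sym cong_trans mult.right_neutral)
  then show "b = (\<alpha> * r) mod a"
    by (simp add: b cong_def)
qed

text \<open>
  The expansion about \<open>x = 1\<close> of \<open>(n / \<Psi>\<^sub>n(x))\<^sup>r\<close> in powers of \<open>1 - x\<close>, as a formal power series in
  the variable \<open>t = 1 - x\<close>, i.e. after substituting \<open>x = 1 - t\<close>.
\<close>

definition Psi_expansion :: "nat \<Rightarrow> nat \<Rightarrow> rat fps" where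
  "Psi_expansion r n = (of_nat n / fps_of_poly (pcompose (Psi n) (1 - X))) ^ r"

definition recip_bernoulli :: "nat \<Rightarrow> nat \<Rightarrow> nat \<Rightarrow> rat" where
  "recip_bernoulli r k n = (-1) ^ k * fact k * fps_nth (Psi_expansion r n) k"

lemma Psi_expansion_eq:
  "Psi_expansion r n = Abs_fps (\<lambda>k. (-1) ^ k * (recip_bernoulli r k n / fact k))"
  by (rule fps_ext) (simp add: recip_bernoulli_def flip: power_mult_distrib mult.assoc)

text \<open>The denominator is a unit of the power series ring, so the division is the genuine one.\<close>

lemma Psi_shifted_nth_0: "fps_nth (fps_of_poly (pcompose (Psi n) (1 - X))) 0 = of_nat n"
  by (simp add: Psi_def poly_0_coeff_0[symmetric] poly_pcompose poly_sum)

end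

theory Submission
  imports Defs
begin

text \<open>
  Let \<open>t = 1 - x\<close>. Because \<open>1 - x\<^sup>n = t \<Psi>\<^sub>n\<close>, the rational function on the left-hand side is
  \<open>p / (t\<^bsup>m+s\<^esup> \<Prod>\<^sub>j \<Psi>\<^bsub>n j\<^esub>\<^bsup>r j\<^esup>)\<close>, and the denominators \<open>t\<^bsup>m+s\<^esup>\<close> and \<open>\<Psi>\<^bsub>n j\<^esub>\<^bsup>r j\<^esup>\<close> are pairwise coprime:
  \<open>\<Psi>\<^sub>n(1) = n \<noteq> 0\<close>, and for coprime \<open>a, b\<close> a common divisor of \<open>\<Psi>\<^sub>a\<close> and \<open>\<Psi>\<^sub>b\<close> divides \<open>1 - x\<^sup>a\<close> and
  \<open>1 - x\<^sup>b\<close>, hence \<open>1 - x\<close>. The total degree of the denominators is \<open>m + \<Sum>\<^sub>j r\<^sub>j n\<^sub>j > deg p\<close>, so the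
  function is the sum of fractions \<open>h\<^sub>i / a\<^sub>i\<close>, as soon as each \<open>h\<^sub>i\<close> has degree below that of
  \<open>a\<^sub>i\<close> and times the other denominators is congruent to \<open>p\<close> modulo \<open>a\<^sub>i\<close>
  (\<open>poly_eq_sum_residues_mult_cofactors\<close>).

  For \<open>a\<^sub>j = \<Psi>\<^bsub>n j\<^esub>\<^bsup>r j\<^esup>\<close> the numerator with these properties is by definition a value of the evaluation
  operator (\<open>eval_mod_residue\<close>); multiplying numerator and denominator by \<open>t\<^bsup>r j\<^esup>\<close> gives \<open>g\<^sub>j\<close>, and the
  digits of \<open>g\<^sub>j\<close> in base \<open>1 - x\<^bsup>n j\<^esup>\<close> are the \<open>g\<^bsub>ij\<^esub>\<close> (\<open>poly_base_expansion\<close>).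

  For \<open>a\<^sub>0 = t\<^bsup>m+s\<^esup>\<close> the numerator is the truncation after \<open>m + s\<close> terms of the expansion of
  \<open>p / \<Prod>\<^sub>j \<Psi>\<^bsub>n j\<^esub>\<^bsup>r j\<^esup>\<close> in powers of \<open>t\<close> (\<open>one_minus_X_power_dvd_diff_truncation\<close>). Its coefficients are
  the \<open>c\<^sub>j\<close>: the expansion is a product of the Taylor series of \<open>p\<close> and the generating series of the
  reciprocal degenerate Bernoulli numbers, up to the constant \<open>\<Prod>\<^sub>j n\<^sub>j\<^bsup>r j\<^esup>\<close>
  (\<open>fps_nth_mult_prod_Psi_expansion\<close>).
\<close>

section \<open>Partial fractions with pairwise coprime denominators\<close>

text \<open>The difference of the two sides is divisible by every \<open>a i\<close>, hence by their product, whose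
  degree exceeds that of the difference. So the difference vanishes.\<close>

lemma poly_eq_sum_residues_mult_cofactors:
  fixes p :: "'a :: field_gcd poly" and a h :: "'i \<Rightarrow> 'a poly"
  assumes fin: "finite I"
    and nz: "\<And>i. i \<in> I \<Longrightarrow> a i \<noteq> 0"
    and coprime: "\<And>i j. i \<in> I \<Longrightarrow> j \<in> I \<Longrightarrow> i \<noteq> j \<Longrightarrow> coprime (a i) (a j)"
    and deg_p: "degree p < (\<Sum>i\<in>I. degree (a i))"
    and deg_h: "\<And>i. i \<in> I \<Longrightarrow> degree (h i) < degree (a i)"
    and residue: "\<And>i. i \<in> I \<Longrightarrow> [h i * (\<Prod>l\<in>I - {i}. a l) = p] (mod a i)"
  shows "p = (\<Sum>i\<in>I. h i * (\<Prod>l\<in>I - {i}. a l))"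
proof (rule ccontr)
  assume neq: "p \<noteq> (\<Sum>i\<in>I. h i * (\<Prod>l\<in>I - {i}. a l))"
  define d where "d = p - (\<Sum>i\<in>I. h i * (\<Prod>l\<in>I - {i}. a l))"
  have "[p = (\<Sum>i\<in>I. h i * (\<Prod>l\<in>I - {i}. a l))] (mod a i)" if i: "i \<in> I" for i
  proof -
    have "a i dvd h j * (\<Prod>l\<in>I - {j}. a l)" if "j \<in> I - {i}" for j
      by (rule dvd_mult, rule dvd_prodI) (use fin i that in auto)
    then have "a i dvd (\<Sum>j\<in>I - {i}. h j * (\<Prod>l\<in>I - {j}. a l))"
      by (rule dvd_sum)
    then have "[h i * (\<Prod>l\<in>I - {i}. a l) + (\<Sum>j\<in>I - {i}. h j * (\<Prod>l\<in>I - {j}. a l)) = p + 0] (mod a i)"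
      by (intro cong_add residue i) (simp add: cong_0_iff)
    then show ?thesis
      using fin i by (simp add: sum.remove[of I i] cong_sym_eq)
  qed
  then have "[p = (\<Sum>i\<in>I. h i * (\<Prod>l\<in>I - {i}. a l))] (mod (\<Prod>i\<in>I. a i))"
    using coprime by (intro cong_cong_prod_coprime) auto
  then have "(\<Prod>i\<in>I. a i) dvd d"
    by (simp add: d_def cong_iff_dvd_diff)
  then have "degree (\<Prod>i\<in>I. a i) \<le> degree d"
    using neq by (intro dvd_imp_degree_le) (auto simp: d_def)
  moreover have deg_prod: "degree (\<Prod>i\<in>J. a i) = (\<Sum>i\<in>J. degree (a i))" if "J \<subseteq> I" for J
    using nz that by (intro degree_prod_sum_eq) auto
  moreover have "degree d < (\<Sum>i\<in>I. degree (a i))"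
  proof -
    have "degree (h i * (\<Prod>l\<in>I - {i}. a l)) < (\<Sum>i\<in>I. degree (a i))" if i: "i \<in> I" for i
    proof -
      have "degree (h i * (\<Prod>l\<in>I - {i}. a l)) \<le> degree (h i) + (\<Sum>l\<in>I - {i}. degree (a l))"
        using degree_mult_le[of "h i" "\<Prod>l\<in>I - {i}. a l"] by (simp add: deg_prod)
      also have "\<dots> < degree (a i) + (\<Sum>l\<in>I - {i}. degree (a l))"
        using deg_h[OF i] by simp
      finally show ?thesis
        using fin i by (simp add: sum.remove[of I i])
    qed
    then have "degree (\<Sum>i\<in>I. h i * (\<Prod>l\<in>I - {i}. a l)) < (\<Sum>i\<in>I. degree (a i))"
      using deg_p by (intro degree_sum_less) auto
    then show ?thesis
      unfolding d_def using deg_p by (intro degree_diff_less) auto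
  qed
  ultimately show False by simp
qed

lemma to_fract_power: "to_fract (x ^ n) = to_fract x ^ n"
  by (induction n) simp_all

lemma to_fract_prod: "to_fract (\<Prod>i\<in>A. f i) = (\<Prod>i\<in>A. to_fract (f i))"
  by (induction A rule: infinite_finite_induct) simp_all

text \<open>The polynomial identity of \<open>poly_eq_sum_residues_mult_cofactors\<close>, divided by all denominators.\<close>

lemma fract_eq_sum_partial_fractions:
  assumes "finite I" and "\<And>i. i \<in> I \<Longrightarrow> a i \<noteq> 0"
    and p: "p = (\<Sum>i\<in>I. h i * (\<Prod>l\<in>I - {i}. a l))"
  shows "to_fract p / (\<Prod>i\<in>I. to_fract (a i)) = (\<Sum>i\<in>I. to_fract (h i) / to_fract (a i))"
proof -
  have "to_fract (h i * (\<Prod>l\<in>I - {i}. a l)) / (\<Prod>i\<in>I. to_fract (a i)) = to_fract (h i) / to_fract (a i)"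
    if "i \<in> I" for i
  proof -
    let ?b = "\<Prod>l\<in>I - {i}. to_fract (a l)"
    have "?b \<noteq> 0"
      using assms(1,2) by simp
    then have "to_fract (h i) * ?b / (to_fract (a i) * ?b) = to_fract (h i) / to_fract (a i)"
      by simp
    moreover have "(\<Prod>l\<in>I. to_fract (a l)) = to_fract (a i) * ?b"
      using assms(1) that by (rule prod.remove)
    ultimately show ?thesis
      by (simp only: to_fract_mult to_fract_prod)
  qed
  then show ?thesis
    by (simp add: p sum_divide_distrib del: to_fract_mult)
qed

text \<open>Repeated division with remainder by \<open>b\<close>: the remainders are the digits, and each quotient loses
  \<open>degree b\<close>.\<close>

lemma poly_base_expansion:
  fixes b f :: "'a :: field poly"
  assumes "degree b > 0" and "degree f < Suc d * degree b"
  shows "\<exists>G. (\<forall>i\<le>d. degree (G i) < degree b) \<and> f = (\<Sum>i\<le>d. G i * b ^ i)"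
  using assms(2)
proof (induction d arbitrary: f)
  case 0
  then show ?case by (intro exI[of _ "\<lambda>_. f"]) simp
next
  case (Suc d)
  have b: "b \<noteq> 0" using assms(1) by auto
  have "degree (f div b) < Suc d * degree b"
  proof (cases "f div b = 0")
    case False
    have "degree (f mod b) < degree b"
      using degree_mod_less[OF b, of f] assms(1) by auto
    also have "degree b \<le> degree (f div b * b)"
      using False b by (simp add: degree_mult_eq)
    finally have "degree (f div b * b + f mod b) = degree (f div b * b)"
      by (rule degree_add_eq_left)
    then have "degree f = degree (f div b) + degree b"
      using False b by (simp add: degree_mult_eq)
    then show ?thesis
      using Suc.prems by simp
  qed (use assms(1) in simp)
  from Suc.IH[OF this] obtain G where G: "\<And>i. i \<le> d \<Longrightarrow> degree (G i) < degree b"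
    and f: "f div b = (\<Sum>i\<le>d. G i * b ^ i)" by blast
  \<comment> \<open>The remainder is the lowest digit; the digits of the quotient move up by one place.\<close>
  have "degree (case i of 0 \<Rightarrow> f mod b | Suc i \<Rightarrow> G i) < degree b" if "i \<le> Suc d" for i
    using that G degree_mod_less[OF b, of f] assms(1) by (cases i) auto
  moreover have "f = (\<Sum>i\<le>Suc d. (case i of 0 \<Rightarrow> f mod b | Suc i \<Rightarrow> G i) * b ^ i)"
  proof -
    have "f = f mod b + f div b * b" by simp
    also have "\<dots> = f mod b + (\<Sum>i\<le>d. G i * b ^ Suc i)"
      by (simp add: f sum_distrib_left mult_ac)
    also have "\<dots> = (\<Sum>i\<le>Suc d. (case i of 0 \<Rightarrow> f mod b | Suc i \<Rightarrow> G i) * b ^ i)"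
      by (subst sum.atMost_Suc_shift) simp
    finally show ?thesis .
  qed
  ultimately show ?case by (intro exI[of _ "case_nat (f mod b) G"]) (auto split: nat.splits)
qed

section \<open>The polynomials \<open>\<Psi>\<^sub>n\<close>\<close>

lemma degree_one_minus_X [simp]: "degree (1 - X) = 1"
  by (simp add: one_pCons)

lemma one_minus_X_neq_0 [simp]: "1 - X \<noteq> 0"
  using degree_one_minus_X by (metis degree_0 zero_neq_one)

lemma degree_one_minus_X_power: "degree (1 - X ^ n) = n"
proof (cases "n = 0")
  case False
  have "degree (X ^ n) = n"
    by (simp add: degree_power_eq)
  then show ?thesis
    using False degree_add_eq_right[of 1 "- (X ^ n)"] by simp
qed simp

lemma one_minus_X_power_neq_0: "n > 0 \<Longrightarrow> 1 - X ^ n \<noteq> 0"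
  using degree_one_minus_X_power[of n] by (metis degree_0 less_irrefl)

lemma Psi_neq_0: "n > 0 \<Longrightarrow> Psi n \<noteq> 0"
  using one_minus_X_mult_Psi[of n] one_minus_X_power_neq_0[of n] by auto

lemma degree_Psi: "n > 0 \<Longrightarrow> degree (Psi n) = n - 1"
  using degree_mult_eq[OF one_minus_X_neq_0 Psi_neq_0, of n]
  unfolding one_minus_X_mult_Psi degree_one_minus_X_power degree_one_minus_X by simp

text \<open>Modulo \<open>1 - x\<close> the polynomial \<open>\<Psi>\<^sub>n\<close> is the constant \<open>n\<close>, a unit over the rationals.\<close>

lemma coprime_one_minus_X_Psi:
  assumes "n > 0"
  shows "coprime (1 - X) (Psi n)"
proof (rule coprimeI)
  fix d assume d: "d dvd 1 - X" "d dvd Psi n"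
  have "[X = 1] (mod d)"
    using d(1) by (simp add: cong_iff_dvd_diff dvd_diff_commute)
  then have "[Psi n = (\<Sum>i<n. 1 ^ i)] (mod d)"
    unfolding Psi_def by (intro cong_sum cong_pow)
  then have "d dvd of_nat n"
    using d(2) by (simp add: cong_dvd_iff)
  moreover have "is_unit (of_nat n :: rat poly)"
    using assms by (simp add: of_nat_poly is_unit_triv)
  ultimately show "is_unit d" by (rule dvd_trans)
qed

text \<open>Modulo a common divisor \<open>d\<close> both \<open>x\<^sup>a\<close> and \<open>x\<^sup>b\<close> are \<open>1\<close>, and by Bezout so is \<open>x\<close>. Thus \<open>d\<close> divides
  \<open>1 - x\<close>, which is coprime to \<open>\<Psi>\<^sub>a\<close>.\<close>

lemma coprime_Psi_Psi:
  assumes "coprime a b" and "a > 0" and "b > 0"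
  shows "coprime (Psi a) (Psi b)"
proof (rule coprimeI)
  fix d assume d: "d dvd Psi a" "d dvd Psi b"
  have one: "[X ^ n = 1] (mod d)" if "d dvd Psi n" for n
    using dvd_mult[OF that, of "1 - X"]
    by (simp add: one_minus_X_mult_Psi cong_iff_dvd_diff dvd_diff_commute)
  obtain x y where xy: "a * x = b * y + 1"
    using bezout_nat[of a b] assms by auto
  have "[X ^ (a * x) = 1] (mod d)"
    using cong_pow[OF one[OF d(1)], of x] by (simp add: power_mult)
  moreover have "[X ^ (b * y) = 1] (mod d)"
    using cong_pow[OF one[OF d(2)], of y] by (simp add: power_mult)
  then have "[X ^ (b * y) * X = 1 * X] (mod d)"
    by (rule cong_mult) simp
  then have "[X ^ (a * x) = X] (mod d)"
    by (simp only: xy power_add power_one_right mult_1)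
  ultimately have "[X = 1] (mod d)"
    using cong_sym cong_trans by blast
  then have "d dvd 1 - X"
    by (simp add: cong_iff_dvd_diff dvd_diff_commute)
  then show "is_unit d"
    using coprime_one_minus_X_Psi[OF assms(2)] d(1) by (blast intro: coprime_common_divisor)
qed

section \<open>Expansion about \<open>x = 1\<close>\<close>

text \<open>Substituting \<open>1 - x\<close> for \<open>x\<close> moves the expansion point \<open>1\<close> to \<open>0\<close>. The substitution is an involution,
  so divisibility by \<open>x\<^sup>N\<close> after it is divisibility by \<open>(1 - x)\<^sup>N\<close> before it.\<close>

lemma one_minus_X_pcompose_self: "pcompose (1 - X) (1 - X) = X"
  by (simp add: one_pCons pcompose_pCons)

lemma one_minus_X_pcompose_involution: "pcompose (pcompose q (1 - X)) (1 - X) = q"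
  by (simp add: one_minus_X_pcompose_self flip: pcompose_assoc)

lemma pcompose_power: "pcompose (p ^ n) q = pcompose p q ^ n"
  for p q :: "'a :: comm_ring_1 poly"
  by (induction n) (simp_all add: pcompose_1 pcompose_mult)

lemma higher_pderiv_pcompose_one_minus_X:
  "(pderiv ^^ i) (pcompose p (1 - X)) = (-1) ^ i * pcompose ((pderiv ^^ i) p) (1 - X)"
proof (induction i)
  case (Suc i)
  have "pderiv ((-1) ^ i * q) = (-1) ^ i * pderiv q" for q :: "rat poly"
    by (cases "even i") (simp_all add: pderiv_minus)
  moreover have "pderiv (1 - X) = -1"
    by (simp add: one_pCons pderiv_pCons)
  ultimately show ?case
    by (simp add: Suc pderiv_pcompose)
qed simp

text \<open>Taylor's formula for \<open>p\<close> at \<open>1\<close>; the sign comes from expanding in \<open>1 - x\<close> rather than \<open>x - 1\<close>.\<close>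

lemma coeff_pcompose_one_minus_X:
  "coeff (pcompose p (1 - X)) i = (-1) ^ i * (poly ((pderiv ^^ i) p) 1 / fact i)"
proof -
  let ?q = "pcompose p (1 - X)"
  have "fact i * coeff ?q i = coeff ((pderiv ^^ i) ?q) 0"
    by (simp add: coeff_higher_pderiv pochhammer_fact)
  also have "\<dots> = poly ((pderiv ^^ i) ?q) 0"
    by (simp add: poly_0_coeff_0)
  also have "\<dots> = (-1) ^ i * poly ((pderiv ^^ i) p) 1"
    by (simp add: higher_pderiv_pcompose_one_minus_X poly_pcompose)
  finally show ?thesis
    by (simp add: field_simps)
qed

text \<open>Iterated Cauchy product. The upper bound \<open>N\<close> on the exponents only serves to keep the index set
  finite; it stays fixed while the coefficient index \<open>j\<close> decreases in the induction.\<close>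

lemma fps_nth_prod_PiE:
  fixes f :: "'i \<Rightarrow> 'a :: comm_semiring_1 fps"
  assumes "finite A" and "j \<le> N"
  shows "fps_nth (\<Prod>l\<in>A. f l) j =
    (\<Sum>i\<in>{i \<in> A \<rightarrow>\<^sub>E {0..N}. (\<Sum>l\<in>A. i l) = j}. \<Prod>l\<in>A. fps_nth (f l) (i l))"
  using assms
proof (induction A arbitrary: j rule: finite_induct)
  case empty
  then show ?case by (auto simp: PiE_empty_domain)
next
  case (insert a A)
  let ?S = "\<lambda>A j. {i \<in> A \<rightarrow>\<^sub>E {0..N}. (\<Sum>l\<in>A. i l) = j}"
  have fin: "finite (?S A j)" for j
    using insert.hyps by (simp add: finite_PiE)
  have "fps_nth (\<Prod>l\<in>insert a A. f l) j =
      (\<Sum>x=0..j. fps_nth (f a) x * (\<Sum>i\<in>?S A (j - x). \<Prod>l\<in>A. fps_nth (f l) (i l)))"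
    using insert by (simp add: fps_mult_nth)
  also have "\<dots> = (\<Sum>(x, i)\<in>(SIGMA x:{0..j}. ?S A (j - x)).
      fps_nth (f a) x * (\<Prod>l\<in>A. fps_nth (f l) (i l)))"
    by (simp add: sum_distrib_left sum.Sigma fin)
  also have "\<dots> = (\<Sum>i\<in>?S (insert a A) j. \<Prod>l\<in>insert a A. fps_nth (f l) (i l))"
  proof (rule sum.reindex_bij_witness[where
        i = "\<lambda>i. (i a, i(a := undefined))" and j = "\<lambda>(x, i). i(a := x)"], goal_cases)
    case (1 z)
    then show ?case using insert.hyps by (auto simp: PiE_def extensional_def fun_eq_iff)
  next
    case (2 z)
    then obtain x i where z: "z = (x, i)" "x \<le> j" "i \<in> A \<rightarrow>\<^sub>E {0..N}" "(\<Sum>l\<in>A. i l) = j - x"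
      by auto
    have "(\<Sum>l\<in>A. (i(a := x)) l) = (\<Sum>l\<in>A. i l)"
      using insert.hyps by (intro sum.cong) auto
    moreover have "i(a := x) \<in> insert a A \<rightarrow>\<^sub>E {0..N}"
      using z insert.prems by (auto simp: PiE_def extensional_def)
    ultimately show ?case
      using z insert.hyps by simp
  next
    case (3 i)
    then show ?case by simp
  next
    case (4 i)
    then have i: "i \<in> insert a A \<rightarrow>\<^sub>E {0..N}" "i a + (\<Sum>l\<in>A. i l) = j"
      using insert.hyps by auto
    have "(\<Sum>l\<in>A. (i(a := undefined)) l) = (\<Sum>l\<in>A. i l)"
      using insert.hyps by (intro sum.cong) auto
    moreover have "i(a := undefined) \<in> A \<rightarrow>\<^sub>E {0..N}"
      using i insert.hyps by (auto simp: PiE_def extensional_def)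
    ultimately show ?case
      using i by auto
  next
    case (5 z)
    obtain x i where z: "z = (x, i)" by force
    have "(\<Prod>l\<in>A. fps_nth (f l) ((i(a := x)) l)) = (\<Prod>l\<in>A. fps_nth (f l) (i l))"
      using insert.hyps by (intro prod.cong) auto
    then show ?case
      using insert.hyps z by simp
  qed
  finally show ?case .
qed

text \<open>In terms of \<open>t = 1 - x\<close> the hypothesis reads \<open>F Q = p\<close>, so \<open>p\<close> minus the truncation of \<open>F\<close>
  times \<open>Q\<close> is \<open>Q\<close> times the tail of \<open>F\<close>, a series without terms below \<open>t\<^sup>N\<close>.\<close>

lemma one_minus_X_power_dvd_diff_truncation:
  assumes F: "F * fps_of_poly (pcompose Q (1 - X)) = fps_of_poly (pcompose p (1 - X))"
  shows "(1 - X) ^ N dvd p - (\<Sum>j<N. [:fps_nth F j:] * (1 - X) ^ j) * Q"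
proof -
  define H where "H = (\<Sum>j<N. [:fps_nth F j:] * (1 - X) ^ j)"
  have H': "pcompose H (1 - X) = (\<Sum>j<N. monom (fps_nth F j) j)"
    unfolding H_def pcompose_sum pcompose_mult pcompose_power one_minus_X_pcompose_self
    by (simp add: monom_altdef)
  have "coeff (pcompose (p - H * Q) (1 - X)) i = 0" if "i < N" for i
  proof -
    have "fps_of_poly (pcompose (p - H * Q) (1 - X)) =
        (F - fps_of_poly (pcompose H (1 - X))) * fps_of_poly (pcompose Q (1 - X))"
      by (simp add: pcompose_diff pcompose_mult fps_of_poly_diff fps_of_poly_mult F left_diff_distrib)
    moreover have "fps_nth (F - fps_of_poly (pcompose H (1 - X))) l = 0" if "l < N" for l
      using that by (simp add: H' coeff_sum)
    ultimately have "fps_nth (fps_of_poly (pcompose (p - H * Q) (1 - X))) i = 0"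
      using \<open>i < N\<close> by (simp only: fps_mult_nth) (intro sum.neutral, auto)
    then show ?thesis by simp
  qed
  then have "monom 1 N dvd pcompose (p - H * Q) (1 - X)"
    by (simp add: monom_1_dvd_iff')
  then obtain u where "pcompose (p - H * Q) (1 - X) = monom 1 N * u" ..
  then have "pcompose (pcompose (p - H * Q) (1 - X)) (1 - X) = pcompose (X ^ N * u) (1 - X)"
    by (simp add: monom_altdef)
  then have "p - H * Q = (1 - X) ^ N * pcompose u (1 - X)"
    by (simp add: one_minus_X_pcompose_involution pcompose_mult pcompose_power pcompose_pCons)
  then show ?thesis by (simp add: H_def)
qed

lemma fps_const_prod: "fps_const (\<Prod>i\<in>A. c i) = (\<Prod>i\<in>A. fps_const (c i))"
  by (induction A rule: infinite_finite_induct) (simp_all flip: fps_const_mult)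

lemma Psi_expansion_mult:
  assumes "n > 0"
  shows "Psi_expansion r n * fps_of_poly (pcompose (Psi n ^ r) (1 - X)) = fps_const (of_nat n ^ r)"
proof -
  let ?P = "fps_of_poly (pcompose (Psi n) (1 - X))"
  have "fps_nth ?P 0 \<noteq> 0"
    using assms by (simp only: Psi_shifted_nth_0)
  then have "of_nat n / ?P * ?P = of_nat n"
    by (simp add: fps_divide_unit mult.assoc inverse_mult_eq_1)
  then have "(of_nat n / ?P) ^ r * ?P ^ r = of_nat n ^ r"
    by (simp flip: power_mult_distrib)
  then show ?thesis
    by (simp add: Psi_expansion_def pcompose_power fps_of_poly_power fps_of_nat
        flip: fps_const_power)
qed

text \<open>The signs \<open>(-1)\<^bsup>i l\<^esup>\<close> of the Taylor coefficients of \<open>p\<close> and of the Bernoulli series multiply to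
  \<open>(-1)\<^sup>j\<close>, since the exponents \<open>i l\<close> add up to \<open>j\<close>.\<close>

lemma fps_nth_mult_prod_Psi_expansion:
  fixes k :: nat
  shows "fps_nth (fps_of_poly (pcompose p (1 - X)) * (\<Prod>l=1..k. Psi_expansion (r l) (n l))) j =
    (\<Sum>i\<in>{i \<in> {0..k} \<rightarrow>\<^sub>E {0..j}. (\<Sum>l=0..k. i l) = j}.
      (-1) ^ j * (poly ((pderiv ^^ i 0) p) 1 / fact (i 0)) *
      ((\<Prod>l=1..k. recip_bernoulli (r l) (i l) (n l)) / (\<Prod>l=1..k. fact (i l))))"
proof -
  define f where "f l = (if l = 0 then fps_of_poly (pcompose p (1 - X))
    else Psi_expansion (r l) (n l))" for l
  have "(\<Prod>l=0..k. f l) = fps_of_poly (pcompose p (1 - X)) * (\<Prod>l=1..k. Psi_expansion (r l) (n l))"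
    by (simp add: prod.atLeast_Suc_atMost[of 0 k] f_def)
  then have "fps_nth (fps_of_poly (pcompose p (1 - X)) * (\<Prod>l=1..k. Psi_expansion (r l) (n l))) j =
      (\<Sum>i\<in>{i \<in> {0..k} \<rightarrow>\<^sub>E {0..j}. (\<Sum>l=0..k. i l) = j}. \<Prod>l=0..k. fps_nth (f l) (i l))"
    using fps_nth_prod_PiE[of "{0..k}" j j f] by simp
  also have "\<dots> = (\<Sum>i\<in>{i \<in> {0..k} \<rightarrow>\<^sub>E {0..j}. (\<Sum>l=0..k. i l) = j}.
      (-1) ^ j * (poly ((pderiv ^^ i 0) p) 1 / fact (i 0)) *
      ((\<Prod>l=1..k. recip_bernoulli (r l) (i l) (n l)) / (\<Prod>l=1..k. fact (i l))))"
  proof (rule sum.cong[OF refl])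
    fix i assume "i \<in> {i \<in> {0..k} \<rightarrow>\<^sub>E {0..j}. (\<Sum>l=0..k. i l) = j}"
    then have i: "(\<Sum>l=0..k. i l) = j" by simp
    have "fps_nth (f l) (i l) = (-1) ^ i l * (if l = 0 then poly ((pderiv ^^ i 0) p) 1 / fact (i 0)
        else recip_bernoulli (r l) (i l) (n l) / fact (i l))" for l
      by (simp add: f_def coeff_pcompose_one_minus_X Psi_expansion_eq)
    then have "(\<Prod>l=0..k. fps_nth (f l) (i l)) = (-1) ^ (\<Sum>l=0..k. i l) *
        (\<Prod>l=0..k. if l = 0 then poly ((pderiv ^^ i 0) p) 1 / fact (i 0)
          else recip_bernoulli (r l) (i l) (n l) / fact (i l))"
      by (simp only: prod.distrib power_sum)
    then show "(\<Prod>l=0..k. fps_nth (f l) (i l)) =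
        (-1) ^ j * (poly ((pderiv ^^ i 0) p) 1 / fact (i 0)) *
        ((\<Prod>l=1..k. recip_bernoulli (r l) (i l) (n l)) / (\<Prod>l=1..k. fact (i l)))"
      by (simp add: i prod.atLeast_Suc_atMost[of 0 k] prod_dividef)
  qed
  finally show ?thesis .
qed

section \<open>The evaluation operator\<close>

text \<open>The value \<open>\<alpha> p mod a\<close> solves \<open>b s \<equiv> p\<close> because \<open>\<alpha> s \<equiv> 1\<close>, with \<open>\<alpha>\<close> a Bezout coefficient. This
  is the congruence that a partial fraction numerator over \<open>a\<close> has to satisfy.\<close>

lemma eval_mod_residue:
  assumes "s \<noteq> 0" and coprime: "coprime s a" and a: "degree a > 0"
  shows "[eval_mod (to_fract p / to_fract s) a * s = p] (mod a)"
    and "degree (eval_mod (to_fract p / to_fract s) a) < degree a"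
proof -
  obtain \<alpha> \<beta> where "\<alpha> * s + \<beta> * a = 1"
    using bezout_coefficients_fst_snd[of s a] coprime by (auto simp: coprime_iff_gcd_eq_1)
  then have \<alpha>: "[\<alpha> * s = 1] (mod a)"
    by (metis cong_iff_dvd_diff diff_add_cancel add_diff_cancel_left' dvd_triv_right dvd_diff_commute)
  have eval: "eval_mod (to_fract p / to_fract s) a = (\<alpha> * p) mod a"
    using assms \<alpha> by (intro eval_mod_Fract)
  have "[\<alpha> * p mod a * s = \<alpha> * p * s] (mod a)"
    by (intro cong_mult) simp_all
  also have "\<alpha> * p * s = p * (\<alpha> * s)"
    by (simp add: mult_ac)
  also have "[p * (\<alpha> * s) = p * 1] (mod a)"
    using \<alpha> by (rule cong_scalar_left)
  finally show "[eval_mod (to_fract p / to_fract s) a * s = p] (mod a)"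
    by (simp add: eval)
  show "degree (eval_mod (to_fract p / to_fract s) a) < degree a"
    unfolding eval using degree_mod_less[of a "\<alpha> * p"] a by (metis degree_0 less_irrefl)
qed

section \<open>The partial fraction decomposition\<close>

theorem theorem1p1p2:
  fixes k m s :: nat and n r :: "nat \<Rightarrow> nat" and p :: "rat poly"
  assumes k: "k \<ge> 1"
    and n: "\<And>j. j \<in> {1..k} \<Longrightarrow> n j \<ge> 2"
    and coprime_n: "\<And>i j. i \<in> {1..k} \<Longrightarrow> j \<in> {1..k} \<Longrightarrow> i \<noteq> j \<Longrightarrow> coprime (n i) (n j)"
    and r: "\<And>j. j \<in> {1..k} \<Longrightarrow> r j \<ge> 1"
    and s: "s = (\<Sum>j=1..k. r j)"
    and deg_p: "degree p < m + (\<Sum>j=1..k. r j * n j)"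
  shows "\<exists>(c :: nat \<Rightarrow> rat) (g :: nat \<Rightarrow> rat poly) (G :: nat \<Rightarrow> nat \<Rightarrow> rat poly).
    to_fract p / to_fract ((1 - X) ^ m) * (\<Prod>j=1..k. 1 / to_fract ((1 - X ^ n j) ^ r j))
      = (\<Sum>j=0..m+s-1. to_fract [:c j:] / to_fract ((1 - X) ^ (m + s - j)))
        + (\<Sum>j=1..k. to_fract (g j) / to_fract ((1 - X ^ n j) ^ r j)) \<and>
    to_fract p / to_fract ((1 - X) ^ m) * (\<Prod>j=1..k. 1 / to_fract ((1 - X ^ n j) ^ r j))
      = (\<Sum>j=0..m+s-1. to_fract [:c j:] / to_fract ((1 - X) ^ (m + s - j)))
        + (\<Sum>j=1..k. \<Sum>i=0..r j - 1. to_fract (G i j) / to_fract ((1 - X ^ n j) ^ (r j - i))) \<and>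
    (\<forall>j\<in>{1..k}. (\<forall>i\<in>{0..r j - 1}. degree (G i j) < n j) \<and>
       g j = (\<Sum>i=0..r j - 1. G i j * (1 - X ^ n j) ^ i)) \<and>
    (\<forall>j\<in>{0..m+s-1}.
       c j = 1 / (\<Prod>l=1..k. of_nat (n l) ^ r l) *
         (\<Sum>i\<in>{i \<in> {0..k} \<rightarrow>\<^sub>E {0..j}. (\<Sum>l=0..k. i l) = j}.
            (-1) ^ j * (poly ((pderiv ^^ i 0) p) 1 / fact (i 0)) *
            ((\<Prod>l=1..k. recip_bernoulli (r l) (i l) (n l)) / (\<Prod>l=1..k. fact (i l))))) \<and>
    (\<forall>j\<in>{1..k}.
       g j = (1 - X) ^ r j *
         eval_mod (to_fract p / to_fract ((1 - X) ^ (m + s)) *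
             (\<Prod>i\<in>{1..k} - {j}. 1 / to_fract (Psi (n i) ^ r i)))
           (Psi (n j) ^ r j) \<and>
       degree (g j) < n j * r j)"
proof -
  \<comment> \<open>The denominators and numerators of the partial fractions; index \<open>0\<close> is the pole at \<open>x = 1\<close>.\<close>
  define a where "a i = (if i = 0 then (1 - X) ^ (m + s) else Psi (n i) ^ r i)" for i
  define F where "F = fps_const (1 / (\<Prod>l=1..k. of_nat (n l) ^ r l)) *
    (fps_of_poly (pcompose p (1 - X)) * (\<Prod>l=1..k. Psi_expansion (r l) (n l)))"
  define c where "c j = fps_nth F j" for j
  define ev where "ev j = eval_mod (to_fract p / to_fract ((1 - X) ^ (m + s)) *
    (\<Prod>i\<in>{1..k} - {j}. 1 / to_fract (Psi (n i) ^ r i))) (Psi (n j) ^ r j)" for j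
  define h where "h i = (if i = 0 then \<Sum>j<m+s. [:c j:] * (1 - X) ^ j else ev i)" for i
  define g where "g j = (1 - X) ^ r j * ev j" for j
  have n_pos: "n j > 0" if "j \<in> {1..k}" for j
    using n[OF that] by simp
  have "r 1 \<le> s"
    unfolding s using k by (intro member_le_sum) auto
  then have ms: "m + s \<ge> 1"
    using r[of 1] k by simp
  have I: "{0..k} = insert 0 {1..k}" by auto

  have a_neq_0: "a i \<noteq> 0" if "i \<in> {0..k}" for i
    using that n_pos[of i] Psi_neq_0[of "n i"] one_minus_X_neq_0 by (auto simp: a_def)
  have a_coprime: "coprime (a i) (a j)" if ij: "i \<in> {0..k}" "j \<in> {0..k}" "i \<noteq> j" for i j
  proof -
    have left: "coprime (a 0) (a l)" if "l \<in> {1..k}" for l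
      using that coprime_one_minus_X_Psi[OF n_pos[OF that]] by (simp add: a_def)
    consider "i = 0" "j \<in> {1..k}" | "j = 0" "i \<in> {1..k}" | "i \<in> {1..k}" "j \<in> {1..k}"
      using ij unfolding I by blast
    then show ?thesis
    proof cases
      case 1
      then show ?thesis using left by simp
    next
      case 2
      then show ?thesis using left coprime_commute by blast
    next
      case 3
      then show ?thesis
        using ij coprime_Psi_Psi[of "n i" "n j"] coprime_n[of i j] n_pos by (simp add: a_def)
    qed
  qed
  have degree_a0: "degree (a 0) = m + s"
    unfolding a_def using degree_power_eq[OF one_minus_X_neq_0] by simp
  have degree_a: "degree (a j) = r j * (n j - 1)" if "j \<in> {1..k}" for j
    using that n_pos[OF that] by (simp add: a_def degree_power_eq Psi_neq_0 degree_Psi)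
  have degree_a_pos: "degree (a j) > 0" if "j \<in> {0..k}" for j
  proof (cases "j = 0")
    case False
    then have j: "j \<in> {1..k}" using that by simp
    then show ?thesis using degree_a[OF j] n[OF j] r[OF j] by simp
  qed (use ms in \<open>simp only: degree_a0\<close>)
  \<comment> \<open>The factors \<open>\<Psi>\<close> lose one degree each against \<open>1 - x\<^sup>n\<close>; the \<open>s\<close> extra factors
    \<open>1 - x\<close> in \<open>a 0\<close> make up for exactly that.\<close>
  have deg_p': "degree p < (\<Sum>i\<in>{0..k}. degree (a i))"
  proof -
    have "(\<Sum>j=1..k. r j * n j) = (\<Sum>j=1..k. r j + degree (a j))"
      by (intro sum.cong refl) (metis Suc_diff_1 degree_a mult_Suc_right n_pos)
    then show ?thesis
      using deg_p degree_a0 unfolding I by (simp add: sum.distrib s)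
  qed

  have ev: "ev j = eval_mod (to_fract p / to_fract (\<Prod>l\<in>{0..k} - {j}. a l)) (a j)"
    if "j \<in> {1..k}" for j
  proof -
    have "{0..k} - {j} = insert 0 ({1..k} - {j})"
      using that by auto
    then have "(\<Prod>l\<in>{0..k} - {j}. a l) = (1 - X) ^ (m + s) * (\<Prod>l\<in>{1..k} - {j}. Psi (n l) ^ r l)"
      by (simp add: a_def)
    then show ?thesis
      using that by (simp add: ev_def a_def to_fract_prod prod_dividef del: to_fract_diff)
  qed
  have ev_residue: "[ev j * (\<Prod>l\<in>{0..k} - {j}. a l) = p] (mod a j)"
    and degree_ev: "degree (ev j) < degree (a j)" if j: "j \<in> {1..k}" for j
  proof -
    have *: "(\<Prod>l\<in>{0..k} - {j}. a l) \<noteq> 0" "coprime (\<Prod>l\<in>{0..k} - {j}. a l) (a j)"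
      using a_neq_0 by simp (rule prod_coprime_left, rule a_coprime, use j in auto)
    have pos: "degree (a j) > 0" using degree_a_pos j by simp
    show "[ev j * (\<Prod>l\<in>{0..k} - {j}. a l) = p] (mod a j)"
      unfolding ev[OF j] by (rule eval_mod_residue(1)[OF * pos])
    show "degree (ev j) < degree (a j)"
      unfolding ev[OF j] by (rule eval_mod_residue(2)[OF * pos])
  qed
  \<comment> \<open>\<open>F\<close> is the expansion of \<open>p / \<Prod>\<^sub>l \<Psi>\<^sup>r\<close> about \<open>x = 1\<close>: the constants \<open>n\<^sup>r\<close> in the numerators of the
    Bernoulli series cancel against the prefactor.\<close>
  have h0_residue: "[h 0 * (\<Prod>l\<in>{0..k} - {0}. a l) = p] (mod a 0)"
  proof -
    have "{0..k} - {0} = {1..k}" by auto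
    moreover have "F * fps_of_poly (pcompose (\<Prod>l=1..k. a l) (1 - X)) = fps_of_poly (pcompose p (1 - X))"
    proof -
      have "(\<Prod>l=1..k. Psi_expansion (r l) (n l)) * fps_of_poly (pcompose (\<Prod>l=1..k. a l) (1 - X))
          = (\<Prod>l=1..k. Psi_expansion (r l) (n l) * fps_of_poly (pcompose (Psi (n l) ^ r l) (1 - X)))"
        by (simp add: pcompose_prod fps_of_poly_prod a_def prod.distrib)
      also have "\<dots> = (\<Prod>l=1..k. fps_const (of_nat (n l) ^ r l))"
        using n_pos by (intro prod.cong refl Psi_expansion_mult) auto
      also have "\<dots> = fps_const (\<Prod>l=1..k. of_nat (n l) ^ r l)"
        by (rule fps_const_prod[symmetric])
      finally have prod_eq: "(\<Prod>l=1..k. Psi_expansion (r l) (n l)) * fps_of_poly (pcompose (\<Prod>l=1..k. a l) (1 - X))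
          = fps_const (\<Prod>l=1..k. of_nat (n l) ^ r l)" .
      have "F * fps_of_poly (pcompose (\<Prod>l=1..k. a l) (1 - X)) =
          fps_const (1 / (\<Prod>l=1..k. of_nat (n l) ^ r l)) *
          ((\<Prod>l=1..k. Psi_expansion (r l) (n l)) * fps_of_poly (pcompose (\<Prod>l=1..k. a l) (1 - X))) *
          fps_of_poly (pcompose p (1 - X))"
        unfolding F_def by (simp only: mult_ac)
      moreover have "(\<Prod>l=1..k. of_nat (n l) ^ r l) \<noteq> (0 :: rat)"
        using n_pos by simp
      ultimately show ?thesis
        unfolding prod_eq fps_const_mult by (simp only: times_divide_eq_left mult_1 divide_self fps_const_1_eq_1 not_False_eq_True)
    qed
    from one_minus_X_power_dvd_diff_truncation[OF this, of "m + s"]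
    have "a 0 dvd p - h 0 * (\<Prod>l=1..k. a l)"
      by (simp add: a_def[of 0] h_def c_def)
    ultimately show ?thesis
      by (simp add: cong_iff_dvd_diff dvd_diff_commute)
  qed
  have degree_h0: "degree (h 0) < degree (a 0)"
  proof -
    have "degree ([:c j:] * (1 - X) ^ j) < m + s" if "j < m + s" for j
    proof -
      have "degree ([:c j:] * (1 - X) ^ j) \<le> degree ([:c j:]) + degree ((1 - X) ^ j)"
        by (rule degree_mult_le)
      also have "\<dots> = j"
        using degree_power_eq[OF one_minus_X_neq_0, of j] by simp
      finally show ?thesis using that by simp
    qed
    then show ?thesis
      unfolding h_def degree_a0 using ms by (auto intro!: degree_sum_less)
  qed

  have "p = (\<Sum>i\<in>{0..k}. h i * (\<Prod>l\<in>{0..k} - {i}. a l))"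
  proof (rule poly_eq_sum_residues_mult_cofactors[OF _ a_neq_0 a_coprime deg_p'])
    fix i assume i: "i \<in> {0..k}"
    show "degree (h i) < degree (a i)"
      using degree_h0 degree_ev[of i] i by (cases "i = 0") (auto simp: h_def)
    show "[h i * (\<Prod>l\<in>{0..k} - {i}. a l) = p] (mod a i)"
      using h0_residue ev_residue[of i] i by (cases "i = 0") (auto simp: h_def)
  qed simp_all
  then have pf: "to_fract p / (\<Prod>i\<in>{0..k}. to_fract (a i)) =
      (\<Sum>i\<in>{0..k}. to_fract (h i) / to_fract (a i))"
    by (intro fract_eq_sum_partial_fractions a_neq_0) simp_all

  have t_neq_0: "to_fract (1 - X) \<noteq> 0"
    using one_minus_X_neq_0 to_fract_eq_0_iff by blast
  have split: "(1 - X ^ n j) ^ r j = (1 - X) ^ r j * Psi (n j) ^ r j" for j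
    by (simp only: one_minus_X_mult_Psi[symmetric] power_mult_distrib)
  have lhs: "to_fract p / to_fract ((1 - X) ^ m) * (\<Prod>j=1..k. 1 / to_fract ((1 - X ^ n j) ^ r j))
      = to_fract p / (\<Prod>i\<in>{0..k}. to_fract (a i))"
  proof -
    have "to_fract ((1 - X) ^ m) * (\<Prod>j=1..k. to_fract ((1 - X ^ n j) ^ r j)) =
        to_fract ((1 - X) ^ m * (\<Prod>j=1..k. (1 - X) ^ r j * Psi (n j) ^ r j))"
      by (simp only: split to_fract_mult to_fract_prod)
    also have "(1 - X) ^ m * (\<Prod>j=1..k. (1 - X) ^ r j * Psi (n j) ^ r j) = (\<Prod>i\<in>{0..k}. a i)"
      unfolding I by (simp add: a_def prod.distrib s power_add power_sum mult.assoc)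
    finally have "to_fract ((1 - X) ^ m) * (\<Prod>j=1..k. to_fract ((1 - X ^ n j) ^ r j)) =
        (\<Prod>i\<in>{0..k}. to_fract (a i))"
      by (simp only: to_fract_prod)
    then show ?thesis
      by (simp only: prod_dividef prod.neutral_const times_divide_times_eq mult_1_right)
  qed
  have "to_fract (h 0) / to_fract (a 0) =
      (\<Sum>j=0..m+s-1. to_fract [:c j:] / to_fract ((1 - X) ^ (m + s - j)))"
  proof -
    have "{..<m + s} = {0..m+s-1}" using ms by auto
    then have "to_fract (h 0) / to_fract (a 0) =
        (\<Sum>j=0..m+s-1. to_fract [:c j:] * to_fract (1 - X) ^ j / to_fract (1 - X) ^ (m + s))"
      by (simp only: h_def a_def refl if_True to_fract_sum to_fract_mult to_fract_power sum_divide_distrib)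
    also have "\<dots> = (\<Sum>j=0..m+s-1. to_fract [:c j:] / to_fract ((1 - X) ^ (m + s - j)))"
    proof (rule sum.cong[OF refl])
      fix j assume "j \<in> {0..m+s-1}"
      then have "m + s = j + (m + s - j)" using ms by auto
      then have "to_fract (1 - X) ^ (m + s) = to_fract (1 - X) ^ j * to_fract (1 - X) ^ (m + s - j)"
        by (metis power_add)
      then show "to_fract [:c j:] * to_fract (1 - X) ^ j / to_fract (1 - X) ^ (m + s) =
          to_fract [:c j:] / to_fract ((1 - X) ^ (m + s - j))"
        using t_neq_0 by (simp add: to_fract_power del: to_fract_diff)
    qed
    finally show ?thesis .
  qed
  moreover have "to_fract (h j) / to_fract (a j) = to_fract (g j) / to_fract ((1 - X ^ n j) ^ r j)"
    if "j \<in> {1..k}" for j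
    using that t_neq_0 by (simp add: h_def a_def g_def split to_fract_power del: to_fract_diff)
  ultimately have first: "to_fract p / to_fract ((1 - X) ^ m) * (\<Prod>j=1..k. 1 / to_fract ((1 - X ^ n j) ^ r j))
      = (\<Sum>j=0..m+s-1. to_fract [:c j:] / to_fract ((1 - X) ^ (m + s - j)))
        + (\<Sum>j=1..k. to_fract (g j) / to_fract ((1 - X ^ n j) ^ r j))"
    unfolding lhs pf by (simp add: I)

  have degree_g: "degree (g j) < n j * r j" if j: "j \<in> {1..k}" for j
  proof -
    have "degree (g j) \<le> degree ((1 - X) ^ r j) + degree (ev j)"
      unfolding g_def by (rule degree_mult_le)
    also have "\<dots> < r j + r j * (n j - 1)"
      using degree_power_eq[OF one_minus_X_neq_0, of "r j"] degree_ev[OF j] degree_a[OF j] by simp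
    also have "\<dots> = n j * r j"
      using n_pos[OF j] by (cases "n j") simp_all
    finally show ?thesis .
  qed
  have "\<exists>G. (\<forall>i\<le>r j - 1. degree (G i) < n j) \<and> g j = (\<Sum>i\<le>r j - 1. G i * (1 - X ^ n j) ^ i)"
    if "j \<in> {1..k}" for j
    using poly_base_expansion[of "1 - X ^ n j" "g j" "r j - 1"] degree_g[OF that] r[OF that] n_pos[OF that]
    by (simp add: degree_one_minus_X_power mult.commute)
  then obtain G' where G': "\<And>j. j \<in> {1..k} \<Longrightarrow> (\<forall>i\<le>r j - 1. degree (G' j i) < n j) \<and>
      g j = (\<Sum>i\<le>r j - 1. G' j i * (1 - X ^ n j) ^ i)"
    by metis
  define G where "G i j = G' j i" for i j
  have G: "(\<forall>i\<in>{0..r j - 1}. degree (G i j) < n j) \<and>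
      g j = (\<Sum>i=0..r j - 1. G i j * (1 - X ^ n j) ^ i)" if "j \<in> {1..k}" for j
    using G'[OF that] by (auto simp: G_def atMost_atLeast0)

  \<comment> \<open>Dividing the digit expansion of \<open>g j\<close> by the \<open>r j\<close>-th power of the base.\<close>
  have second: "(\<Sum>j=1..k. to_fract (g j) / to_fract ((1 - X ^ n j) ^ r j)) =
      (\<Sum>j=1..k. \<Sum>i=0..r j - 1. to_fract (G i j) / to_fract ((1 - X ^ n j) ^ (r j - i)))"
  proof (rule sum.cong[OF refl])
    fix j assume j: "j \<in> {1..k}"
    define q where "q = to_fract (1 - X ^ n j)"
    have q: "q \<noteq> 0"
      using one_minus_X_power_neq_0[OF n_pos[OF j]] to_fract_eq_0_iff unfolding q_def by blast
    have g_G: "to_fract (g j) = (\<Sum>i=0..r j - 1. to_fract (G i j) * q ^ i)"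
      unfolding q_def conjunct2[OF G[OF j]] by (simp only: to_fract_sum to_fract_mult to_fract_power)
    have "to_fract (G i j) * q ^ i / q ^ r j = to_fract (G i j) / q ^ (r j - i)"
      if "i \<in> {0..r j - 1}" for i
    proof -
      have "r j = i + (r j - i)" using that by auto
      then have "q ^ r j = q ^ i * q ^ (r j - i)" by (metis power_add)
      then show ?thesis using q by simp
    qed
    then have "to_fract (g j) / q ^ r j = (\<Sum>i=0..r j - 1. to_fract (G i j) / q ^ (r j - i))"
      unfolding g_G sum_divide_distrib by (rule sum.cong[OF refl])
    then show "to_fract (g j) / to_fract ((1 - X ^ n j) ^ r j) =
        (\<Sum>i=0..r j - 1. to_fract (G i j) / to_fract ((1 - X ^ n j) ^ (r j - i)))"
      by (simp only: q_def to_fract_power)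
  qed

  have c: "c j = 1 / (\<Prod>l=1..k. of_nat (n l) ^ r l) *
      (\<Sum>i\<in>{i \<in> {0..k} \<rightarrow>\<^sub>E {0..j}. (\<Sum>l=0..k. i l) = j}.
        (-1) ^ j * (poly ((pderiv ^^ i 0) p) 1 / fact (i 0)) *
        ((\<Prod>l=1..k. recip_bernoulli (r l) (i l) (n l)) / (\<Prod>l=1..k. fact (i l))))" for j
    unfolding c_def F_def fps_mult_left_const_nth fps_nth_mult_prod_Psi_expansion ..

  have g_eq: "g j = (1 - X) ^ r j * eval_mod (to_fract p / to_fract ((1 - X) ^ (m + s)) *
      (\<Prod>i\<in>{1..k} - {j}. 1 / to_fract (Psi (n i) ^ r i))) (Psi (n j) ^ r j)" for j
    by (simp only: g_def ev_def)

  show ?thesis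
    by (intro exI[of _ c] exI[of _ g] exI[of _ G] conjI ballI)
      (rule first first[unfolded second] G[THEN conjunct1, THEN bspec] G[THEN conjunct2]
        c g_eq degree_g; assumption)+
qed

end
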